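(* Let $X_1$ ($n\times p_1$) and $X_2$ ($n\times p_2$), with $p_1,p_2>0$ and $p=p_1+p_2$, be such that $X=(X_1,X_2)$ has full column rank and centered columns. Consider the two models $M_1: y=\alpha\mathbf 1+X_1\beta_1+\epsilon$ and $M_2: y=\alpha\mathbf 1+X_1\beta_1+X_2\beta_2+\epsilon$, $\epsilon\sim N(0,\sigma^2I_n)$, each equipped with a hyper-$g$ prior (with the same hyperparameter $a>2$) built from its own design matrix. Consider the sequence of problems $\Psi_N$ in which the data are $y_N=\alpha\mathbf 1+X_1\beta_{1(N)}+X_2\beta_2+\epsilon$, where $X_1,X_2,\alpha,\beta_2,\epsilon$ are held fixed and $\|\beta_{1(N)}\|\to\infty$ as $N\to\infty$. If $n\ge a+p_1-1$, then the Bayes factor $BF(M_2:M_1)\to 0$ as $N\to\infty$, irrespective of the data.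
   Context: Hyper-$g$ prior for a model with design matrix $X_\gamma$: $\pi(\alpha,\sigma^2)\propto1/\sigma^2$; $\beta_\gamma\mid g,\sigma^2\sim N(0,g\sigma^2(X_\gamma^TX_\gamma)^{-1})$; $g$ has density $\frac{a-2}{2}(1+g)^{-a/2}$, $g>0$. The Bayes factor $BF(M_2:M_1)=p(y\mid M_2)/p(y\mid M_1)$ is the ratio of marginal likelihoods (the common improper prior on $(\alpha,\sigma^2)$ is shared). The response is centered and $n>p$.
   Formalization: The formal theorem also assumes that ε is not in the span of 1 and the columns of X, or that n < a+p−1; otherwise the marginal likelihood of M2 is infinite and BF is infinite or undefined (e.g. ε=0, β2≠0). *)

theory Defs
  imports "HOL-Analysis.Analysis"
begin

definition mvn_density :: "real^'k \<Rightarrow> real^'k^'k \<Rightarrow> real^'k \<Rightarrow> real" where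
  "mvn_density mu Cov x =
     (2 * pi) powr (- real CARD('k) / 2) / sqrt (det Cov)
     * exp (- ((x - mu) \<bullet> (matrix_inv Cov *v (x - mu))) / 2)"

definition hyperg_density :: "real \<Rightarrow> real \<Rightarrow> real" where
  "hyperg_density a g = (a - 2) / 2 * (1 + g) powr (- a / 2)"

text \<open>Marginal likelihood p(y | M) of the model y = alpha 1 + Z beta + eps, eps ~ N(0, s2 I),
  with priors pi(alpha, s2) \<propto> 1/s2 (flat in alpha),
  beta | g, s2 ~ N(0, g s2 (Z^T Z)^{-1}), g ~ hyper-g(a).
  The improper prior constant is taken to be 1 (it is common to all models).\<close>
definition marglik :: "real^'k^'n \<Rightarrow> real \<Rightarrow> real^'n \<Rightarrow> ennreal" where
  "marglik Z a y =
     (\<integral>\<^sup>+ g \<in> {0<..}. (\<integral>\<^sup>+ s2 \<in> {0<..}. (\<integral>\<^sup>+ alpha. (\<integral>\<^sup>+ beta.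
        ennreal (mvn_density (alpha *\<^sub>R vec 1 + Z *v beta) (s2 *\<^sub>R mat 1) y
                 * mvn_density 0 ((g * s2) *\<^sub>R matrix_inv (transpose Z ** Z)) beta
                 * (1 / s2) * hyperg_density a g)
      \<partial>lborel) \<partial>lborel) \<partial>lborel) \<partial>lborel)"

definition bayes_factor :: "real^'k2^'n \<Rightarrow> real^'k1^'n \<Rightarrow> real \<Rightarrow> real^'n \<Rightarrow> ennreal" where
  "bayes_factor Z2 Z1 a y = marglik Z2 a y / marglik Z1 a y"

definition concat_cols :: "real^'p1^'n \<Rightarrow> real^'p2^'n \<Rightarrow> real^('p1 + 'p2)^'n" where
  "concat_cols X1 X2 = (\<chi> i j. case j of Inl k \<Rightarrow> X1 $ i $ k | Inr k \<Rightarrow> X2 $ i $ k)"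

end

theory Submission
  imports Defs "HOL-Probability.Distributions"
begin

text \<open>
  Decompose the data orthogonally as \<open>y = c 1 + Z b + r\<close>. Integrating out slope, intercept and variance
  by affine substitutions leaves, up to a factor common to all models and a finite positive factor
  depending only on \<open>Z\<close>, the one-dimensional integral
  \<open>\<integral> (1 + g)^((n - 1 - k - a)/2) (T + g S)^(-(n - 1)/2) dg\<close>, where \<open>k\<close> is the number of columns,
  \<open>T\<close> the total centered sum of squares and \<open>S\<close> the residual one. Along the sequence of problems both residual sums
  of squares stay constant while \<open>T\<close>, the same for both models, tends to infinity. After rescaling by
  \<open>T^((n - 1)/2)\<close> the integral of the smaller model diverges exactly because \<open>n \<ge> a + p1 - 1\<close>; the
  extra factor \<open>(1 + g)^(-p2/2)\<close> of the larger model is small except on a bounded range of \<open>g\<close>, whose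
  contribution stays bounded (or, if \<open>n < a + p - 1\<close>, the whole integral stays bounded).
\<close>

subsection \<open>Matrices and Gaussian densities\<close>

lemma matrix_inv_unique:
  fixes A B :: "real^'k^'k"
  assumes "A ** B = mat 1"
  shows "matrix_inv A = B"
proof -
  have BA: "B ** A = mat 1"
    using assms matrix_left_right_inverse by blast
  have "A ** matrix_inv A = mat 1 \<and> matrix_inv A ** A = mat 1"
    unfolding matrix_inv_def by (rule someI[of _ B]) (use assms BA in auto)
  then have "B ** (A ** matrix_inv A) = B" by simp
  then show ?thesis
    by (simp add: matrix_mul_assoc BA)
qed

lemma scaleR_matrix_mult_scaleR:
  fixes A :: "real^'m^'n" and B :: "real^'k^'m"
  shows "(c *\<^sub>R A) ** (d *\<^sub>R B) = (c * d) *\<^sub>R (A ** B)"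
  by (simp add: vec_eq_iff matrix_matrix_mult_def sum_distrib_left mult_ac)

lemma det_scaleR_matrix:
  fixes A :: "real^'k^'k"
  shows "det (c *\<^sub>R A) = c ^ CARD('k) * det A"
proof -
  have "c *\<^sub>R A = (c *\<^sub>R mat 1) ** (1 *\<^sub>R A)"
    by (simp only: scaleR_matrix_mult_scaleR) simp
  also have "c *\<^sub>R mat 1 = (matrix ((*\<^sub>R) c) :: real^'k^'k)"
    by (simp add: matrix_scaleR vec_eq_iff mat_def)
  finally show ?thesis
    by (simp add: det_mul del: matrix_scaleR)
qed

lemma inverse_sqrt_power_eq_powr:
  assumes "s > 0"
  shows "1 / sqrt (s ^ k) = s powr (- real k / 2)"
proof -
  have "sqrt (s ^ k) = (s powr real k) powr (1 / 2)"
    using assms by (simp add: powr_realpow powr_half_sqrt)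
  also have "\<dots> = s powr (real k / 2)"
    by (simp add: powr_powr)
  finally show ?thesis by (simp only: powr_minus_divide minus_divide_left[symmetric])
qed

lemma gram_quadratic:
  fixes Z :: "real^'k^'n"
  shows "x \<bullet> ((transpose Z ** Z) *v x) = (norm (Z *v x))\<^sup>2"
  unfolding power2_norm_eq_inner matrix_vector_mul_assoc[symmetric]
  by (simp only: dot_lmul_matrix[symmetric] transpose_matrix_vector[symmetric] transpose_transpose)

text \<open>Homotopy to the identity: along the segment from \<open>mat 1\<close> to
  \<open>A\<close> the quadratic form stays positive, so the determinant never vanishes; being
  continuous and equal to 1 at the start, it is positive at the end.\<close>

lemma det_pos_if_quadratic_pos:
  fixes A :: "real^'k^'k"
  assumes pos: "\<And>x. x \<noteq> 0 \<Longrightarrow> x \<bullet> (A *v x) > 0"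
  shows "det A > 0"
proof -
  define M where "M t = (1 - t) *\<^sub>R mat 1 + t *\<^sub>R A" for t :: real
  have nz: "det (M t) \<noteq> 0" if t: "0 \<le> t" "t \<le> 1" for t
  proof -
    have "x = 0" if "M t *v x = 0" for x
    proof (rule ccontr)
      assume x: "x \<noteq> 0"
      have "x \<bullet> (M t *v x) = (1 - t) * (x \<bullet> x) + t * (x \<bullet> (A *v x))"
        by (simp add: M_def matrix_vector_mult_add_rdistrib inner_add_right
            flip: scaleR_matrix_vector_assoc)
      moreover have "\<dots> > 0"
        using pos[OF x] x t
        by (cases "t = 0") (auto intro!: add_nonneg_pos)
      ultimately show False using that by simp
    qed
    then have "inj ((*v) (M t))"
      by (simp add: linear_injective_0[OF matrix_vector_mul_linear])
    then show ?thesis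
      using det_nz_iff_inj[OF matrix_vector_mul_linear, of "M t"] by (simp add: matrix_of_matrix_vector_mul)
  qed
  have "continuous_on {0..1} (\<lambda>t. det (M t))"
    unfolding det_def M_def by (auto intro!: continuous_intros)
  moreover have "0 \<le> det (M 0)" by (simp add: M_def)
  ultimately have "\<exists>t\<ge>0. t \<le> 1 \<and> det (M t) = 0" if "det (M 1) \<le> 0"
    using IVT2'[of "\<lambda>t. det (M t)" 1 0 0] that by auto
  then have "det (M 1) > 0"
    using nz by fastforce
  then show ?thesis by (simp add: M_def)
qed

text \<open>Injectivity makes the Gram matrix positive definite. The sign of the determinant matters
  because the prior density divides by a square root built from it.\<close>

lemma
  fixes Z :: "real^'k^'n"
  assumes inj: "inj ((*v) Z)"
  shows det_inv_gram_pos: "det (matrix_inv (transpose Z ** Z)) > 0"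
    and inv_gram_mult: "matrix_inv (transpose Z ** Z) ** (transpose Z ** Z) = mat 1"
proof -
  let ?W = "transpose Z ** Z"
  have "Z *v x \<noteq> 0" if "x \<noteq> 0" for x
    using inj that by (metis injD matrix_vector_mult_0_right)
  then have "det ?W > 0"
    by (intro det_pos_if_quadratic_pos) (simp add: gram_quadratic)
  then have "invertible ?W" by (simp add: invertible_det_nz)
  then obtain B where B: "?W ** B = mat 1" "B ** ?W = mat 1"
    by (auto simp: invertible_def)
  then have eq: "matrix_inv ?W = B" using matrix_inv_unique by blast
  have "det ?W * det B = 1" using B(1) by (metis det_I det_mul)
  with \<open>det ?W > 0\<close> show "det (matrix_inv ?W) > 0"
    unfolding eq using zero_less_mult_pos[of "det ?W" "det B"] by simp
  show "matrix_inv ?W ** ?W = mat 1" unfolding eq by (rule B)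
qed

text \<open>The substitution rule behind all three inner integrals, over slope, intercept and
  variance; the power of \<open>c\<close> is the Jacobian.\<close>

lemma nn_integral_lborel_affine:
  fixes t :: "'a::euclidean_space"
  assumes [measurable]: "f \<in> borel_measurable borel" and "c \<noteq> 0"
  shows "(\<integral>\<^sup>+x. f x \<partial>lborel) = ennreal (\<bar>c\<bar> ^ DIM('a)) * (\<integral>\<^sup>+x. f (t + c *\<^sub>R x) \<partial>lborel)"
proof -
  have T: "(\<lambda>x. t + c *\<^sub>R x) \<in> lborel \<rightarrow>\<^sub>M borel" by simp
  have "integral\<^sup>N lborel f
      = integral\<^sup>N (density (distr lborel borel (\<lambda>x. t + c *\<^sub>R x)) (\<lambda>_. ennreal (\<bar>c\<bar> ^ DIM('a)))) f"
    by (rule arg_cong[OF lborel_affine[OF \<open>c \<noteq> 0\<close>], of "\<lambda>M. integral\<^sup>N M f"])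
  also have "\<dots> = (\<integral>\<^sup>+x. ennreal (\<bar>c\<bar> ^ DIM('a)) * f x \<partial>distr lborel borel (\<lambda>x. t + c *\<^sub>R x))"
    by (rule nn_integral_density) (simp_all add: assms)
  also have "\<dots> = (\<integral>\<^sup>+x. ennreal (\<bar>c\<bar> ^ DIM('a)) * f (t + c *\<^sub>R x) \<partial>lborel)"
    by (rule nn_integral_distr) (simp_all add: assms)
  also have "\<dots> = ennreal (\<bar>c\<bar> ^ DIM('a)) * (\<integral>\<^sup>+x. f (t + c *\<^sub>R x) \<partial>lborel)"
    by (rule nn_integral_cmult) (simp add: measurable_compose[OF T assms(1)])
  finally show ?thesis .
qed

lemma mvn_density_sampling:
  fixes y mu :: "real^'n"
  assumes s: "s > 0"
  shows "mvn_density mu (s *\<^sub>R mat 1) y =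
    (2 * pi) powr (- real CARD('n) / 2) * s powr (- real CARD('n) / 2) * exp (- (norm (y - mu))\<^sup>2 / (2 * s))"
proof -
  have "(s *\<^sub>R mat 1) ** ((1 / s) *\<^sub>R mat 1 :: real^'n^'n) = mat 1"
    using s by (simp add: scaleR_matrix_mult_scaleR)
  then have inv: "matrix_inv (s *\<^sub>R mat 1 :: real^'n^'n) = (1 / s) *\<^sub>R mat 1"
    by (rule matrix_inv_unique)
  have "- ((y - mu) \<bullet> (matrix_inv (s *\<^sub>R mat 1) *v (y - mu))) / 2 = - (norm (y - mu))\<^sup>2 / (2 * s)"
    by (simp add: inv power2_norm_eq_inner flip: scaleR_matrix_vector_assoc)
  then have "mvn_density mu (s *\<^sub>R mat 1) y = (2 * pi) powr (- real CARD('n) / 2)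
      * (1 / sqrt (det (s *\<^sub>R mat 1 :: real^'n^'n))) * exp (- (norm (y - mu))\<^sup>2 / (2 * s))"
    unfolding mvn_density_def by simp
  also have "1 / sqrt (det (s *\<^sub>R mat 1 :: real^'n^'n)) = s powr (- real CARD('n) / 2)"
    using inverse_sqrt_power_eq_powr[OF s] by (simp add: det_scaleR_matrix)
  finally show ?thesis .
qed

text \<open>The Gram matrix in the prior covariance turns the quadratic form into a multiple of
  \<open>(norm (Z *v b))\<^sup>2\<close>, which lives in the same space as the residual of the
  likelihood, so that the two exponents can be combined.\<close>

lemma mvn_density_prior:
  fixes Z :: "real^'k^'n"
  assumes inj: "inj ((*v) Z)" and h: "h > 0"
  shows "mvn_density 0 (h *\<^sub>R matrix_inv (transpose Z ** Z)) b =
    (2 * pi) powr (- real CARD('k) / 2) / sqrt (det (matrix_inv (transpose Z ** Z)))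
      * h powr (- real CARD('k) / 2) * exp (- (norm (Z *v b))\<^sup>2 / (2 * h))"
proof -
  let ?B = "matrix_inv (transpose Z ** Z)"
  have "(h *\<^sub>R ?B) ** ((1 / h) *\<^sub>R (transpose Z ** Z)) = mat 1"
    using h inv_gram_mult[OF inj] by (simp add: scaleR_matrix_mult_scaleR)
  then have inv: "matrix_inv (h *\<^sub>R ?B) = (1 / h) *\<^sub>R (transpose Z ** Z)"
    by (rule matrix_inv_unique)
  have e: "- ((b - 0) \<bullet> (matrix_inv (h *\<^sub>R ?B) *v (b - 0))) / 2 = - (norm (Z *v b))\<^sup>2 / (2 * h)"
    unfolding inv using gram_quadratic[of b Z]
    by (simp del: scaleR_matrix_vector_assoc flip: scaleR_matrix_vector_assoc)
  have d: "1 / sqrt (det (h *\<^sub>R ?B)) = h powr (- real CARD('k) / 2) / sqrt (det ?B)"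
    using inverse_sqrt_power_eq_powr[OF h, of "CARD('k)"]
    by (simp add: det_scaleR_matrix real_sqrt_mult flip: divide_divide_eq_left)
  have "mvn_density 0 (h *\<^sub>R ?B) b = (2 * pi) powr (- real CARD('k) / 2)
      * (1 / sqrt (det (h *\<^sub>R ?B))) * exp (- (norm (Z *v b))\<^sup>2 / (2 * h))"
    unfolding mvn_density_def e by simp
  then show ?thesis unfolding d by simp
qed

lemma nn_integral_gaussian_finite:
  assumes "c > 0"
  shows "(\<integral>\<^sup>+x. ennreal (exp (- c * (x::real)\<^sup>2)) \<partial>lborel) < \<infinity>"
proof -
  \<comment> \<open>The standard deviation for which the normal density has exponent
    \<open>- c * x\<^sup>2\<close>.\<close>
  define s where "s = sqrt (1 / (2 * c))"
  have s: "s > 0" "2 * s\<^sup>2 = 1 / c" using assms by (auto simp: s_def field_simps)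
  have "integrable lborel (\<lambda>x. sqrt (2 * pi * s\<^sup>2) * normal_density 0 s x)"
    using s by simp
  also have "(\<lambda>x. sqrt (2 * pi * s\<^sup>2) * normal_density 0 s x) = (\<lambda>x. exp (- c * x\<^sup>2))"
    using s assms by (auto simp: normal_density_def fun_eq_iff)
  finally show ?thesis by (simp add: integrable_iff_bounded)
qed

text \<open>An injective linear map is bounded below, so the integrand is dominated by a product of
  one-dimensional Gaussians, and the integral of that product factorises.\<close>

lemma nn_integral_gaussian_linear_finite:
  fixes Z :: "real^'k^'n"
  assumes inj: "inj ((*v) Z)"
  shows "(\<integral>\<^sup>+x. ennreal (exp (- (norm (Z *v x))\<^sup>2 / 2)) \<partial>lborel) < \<infinity>"
proof -
  obtain B where B: "B > 0" "\<And>x. B * norm x \<le> norm (Z *v x)"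
    using linear_inj_bounded_below_pos[OF matrix_vector_mul_linear inj] by blast
  have "(\<integral>\<^sup>+x. ennreal (exp (- (norm (Z *v x))\<^sup>2 / 2)) \<partial>lborel)
      \<le> (\<integral>\<^sup>+x. (\<Prod>b\<in>Basis. ennreal (exp (- (B\<^sup>2 / 2) * ((x::real^'k) \<bullet> b)\<^sup>2))) \<partial>lborel)"
  proof (rule nn_integral_mono)
    fix x :: "real^'k"
    have "(B * norm x)\<^sup>2 \<le> (norm (Z *v x))\<^sup>2"
      using B by (intro power_mono) auto
    also have "(B * norm x)\<^sup>2 = B\<^sup>2 * (\<Sum>b\<in>Basis. (x \<bullet> b)\<^sup>2)"
      by (simp add: power_mult_distrib norm_eq_sqrt_inner euclidean_inner[of x x] sum_nonneg power2_eq_square)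
    finally show "ennreal (exp (- (norm (Z *v x))\<^sup>2 / 2))
        \<le> (\<Prod>b\<in>Basis. ennreal (exp (- (B\<^sup>2 / 2) * (x \<bullet> b)\<^sup>2)))"
      by (simp add: prod_ennreal sum_negf flip: exp_sum sum_distrib_left sum_divide_distrib)
  qed
  also have "\<dots> = (\<Prod>b\<in>(Basis::(real^'k) set). (\<integral>\<^sup>+x. ennreal (exp (- (B\<^sup>2 / 2) * x\<^sup>2)) \<partial>lborel))"
    by (rule nn_integral_lborel_prod) auto
  also have "\<dots> < \<infinity>"
    using nn_integral_gaussian_finite[of "B\<^sup>2 / 2"] B by (simp add: power_less_top_ennreal)
  finally show ?thesis .
qed

subsection \<open>The marginal likelihood as a one-dimensional integral\<close>

text \<open>Left as an integral, as is \<open>variance_mass\<close>: both are common to the two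
  models, and the final comparison is an inequality that survives multiplication by any common
  factor in \<open>ennreal\<close>.\<close>

definition intercept_mass :: "real \<Rightarrow> ennreal" where
  "intercept_mass n = (\<integral>\<^sup>+x. ennreal (exp (- (n * x\<^sup>2) / 2)) \<partial>lborel)"

text \<open>This mass differs between the models, so it has to be finite and nonzero before they can
  be compared.\<close>

definition slope_mass :: "real^'k^'n \<Rightarrow> ennreal" where
  "slope_mass Z = (\<integral>\<^sup>+x. ennreal (exp (- (norm (Z *v x))\<^sup>2 / 2)) \<partial>lborel)"

text \<open>For \<open>m > 0\<close> this is an inverse-gamma integral with value
  \<open>2^m * Gamma(m)\<close>.\<close>

definition variance_mass :: "real \<Rightarrow> ennreal" where
  "variance_mass m = (\<integral>\<^sup>+t\<in>{0<..}. ennreal (t powr (- m - 1) * exp (- 1 / (2 * t))) \<partial>lborel)"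

lemma nn_integral_intercept:
  assumes s: "s > 0"
  shows "(\<integral>\<^sup>+x. ennreal (exp (- (n * (c - x)\<^sup>2) / (2 * s))) \<partial>lborel)
    = ennreal (s powr (1 / 2)) * intercept_mass n"
proof -
  have "(\<integral>\<^sup>+x. ennreal (exp (- (n * (c - x)\<^sup>2) / (2 * s))) \<partial>lborel)
      = ennreal (s powr (1 / 2)) * (\<integral>\<^sup>+x. ennreal (exp (- (n * (c - (c + sqrt s *\<^sub>R x))\<^sup>2) / (2 * s))) \<partial>lborel)"
    using s by (subst nn_integral_lborel_affine[where c = "sqrt s" and t = c]) (simp_all add: powr_half_sqrt)
  also have "(\<lambda>x. - (n * (c - (c + sqrt s *\<^sub>R x))\<^sup>2) / (2 * s)) = (\<lambda>x. - (n * x\<^sup>2) / 2)"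
    using s by (simp add: power_mult_distrib fun_eq_iff)
  finally show ?thesis by (simp add: intercept_mass_def)
qed

lemma borel_measurable_matrix_vector_mult_diff [measurable]:
  fixes Z :: "real^'k^'n"
  shows "(\<lambda>b. Z *v (b - b0)) \<in> borel_measurable borel"
  by (intro borel_measurable_continuous_onI continuous_intros
      continuous_on_compose2[OF matrix_vector_mult_linear_continuous_on[of UNIV Z]]) auto

lemma nn_integral_slope:
  fixes Z :: "real^'k^'n"
  assumes q: "q > 0"
  shows "(\<integral>\<^sup>+b. ennreal (exp (- (q * (norm (Z *v (b - mu)))\<^sup>2) / 2)) \<partial>lborel)
    = ennreal (q powr (- real CARD('k) / 2)) * slope_mass Z"
proof -
  define h where "h = 1 / sqrt q"
  have h: "h > 0" "h\<^sup>2 = 1 / q" using q by (auto simp: h_def power_divide)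
  have hk: "\<bar>h\<bar> ^ DIM(real^'k) = q powr (- real CARD('k) / 2)"
    using inverse_sqrt_power_eq_powr[OF q, of "CARD('k)"] h
    by (simp add: h_def power_one_over real_sqrt_power inverse_eq_divide)
  have "(\<integral>\<^sup>+b. ennreal (exp (- (q * (norm (Z *v (b - mu)))\<^sup>2) / 2)) \<partial>lborel)
      = ennreal (q powr (- real CARD('k) / 2))
        * (\<integral>\<^sup>+b. ennreal (exp (- (q * (norm (Z *v ((mu + h *\<^sub>R b) - mu)))\<^sup>2) / 2)) \<partial>lborel)"
    unfolding hk[symmetric] using h by (intro nn_integral_lborel_affine) simp_all
  also have "(\<lambda>b. - (q * (norm (Z *v ((mu + h *\<^sub>R b) - mu)))\<^sup>2) / 2) = (\<lambda>b. - (norm (Z *v b))\<^sup>2 / 2)"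
    using q h by (simp add: matrix_vector_mult_scaleR power_mult_distrib fun_eq_iff)
  finally show ?thesis by (simp add: slope_mass_def)
qed

lemma nn_integral_variance:
  assumes A: "A > 0"
  shows "(\<integral>\<^sup>+s\<in>{0<..}. ennreal (s powr (- m - 1) * exp (- A / (2 * s))) \<partial>lborel)
    = ennreal (A powr (- m)) * variance_mass m"
proof -
  have "(\<integral>\<^sup>+s\<in>{0<..}. ennreal (s powr (- m - 1) * exp (- A / (2 * s))) \<partial>lborel)
      = ennreal A * (\<integral>\<^sup>+t. ennreal ((A * t) powr (- m - 1) * exp (- A / (2 * (A * t)))) * indicator {0<..} (A * t) \<partial>lborel)"
    using A by (subst nn_integral_lborel_affine[where c = A and t = 0]) simp_all
  also have "\<dots> = ennreal A * (\<integral>\<^sup>+t. ennreal (A powr (- m - 1)) *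
      (ennreal (t powr (- m - 1) * exp (- 1 / (2 * t))) * indicator {0<..} t) \<partial>lborel)"
  proof (rule arg_cong2[where f = "(*)"], rule refl, rule nn_integral_cong)
    fix t :: real
    have "(A * t) powr (- m - 1) * exp (- A / (2 * (A * t)))
        = A powr (- m - 1) * (t powr (- m - 1) * exp (- 1 / (2 * t)))" if "t > 0"
      using A that by (simp add: powr_mult)
    then show "ennreal ((A * t) powr (- m - 1) * exp (- A / (2 * (A * t)))) * indicator {0<..} (A * t)
        = ennreal (A powr (- m - 1)) * (ennreal (t powr (- m - 1) * exp (- 1 / (2 * t))) * indicator {0<..} t)"
      using A by (simp add: indicator_def zero_less_mult_iff ennreal_mult mult.assoc)
  qed
  also have "\<dots> = ennreal (A * A powr (- m - 1)) * variance_mass m"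
    using A by (simp add: nn_integral_cmult variance_mass_def ennreal_mult mult.assoc)
  \<comment> \<open>The single factor \<open>A\<close> is the Jacobian of the substitution
    \<open>s = A * t\<close>.\<close>
  also have "A * A powr (- m - 1) = A powr (- m)"
    using A by (simp add: powr_diff)
  finally show ?thesis .
qed

lemma norm_vec_1: "(norm (vec 1 :: real^'n))\<^sup>2 = real CARD('n)"
  by (simp add: power2_norm_eq_inner inner_vec_def)

text \<open>Completing the square in the slope: posterior mean \<open>g / (1 + g) * b\<close>.\<close>
lemma residual_decomposition:
  fixes Z :: "real^'k^'n" and r :: "real^'n"
  assumes y: "y = c *\<^sub>R vec 1 + Z *v b + r"
    and Z1: "\<And>x. vec 1 \<bullet> (Z *v x) = 0" and r1: "vec 1 \<bullet> r = 0" and rZ: "\<And>x. r \<bullet> (Z *v x) = 0"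
    and g: "g > 0"
  shows "(norm (y - (al *\<^sub>R vec 1 + Z *v x)))\<^sup>2 + (norm (Z *v x))\<^sup>2 / g
    = real CARD('n) * (c - al)\<^sup>2 + ((norm r)\<^sup>2 + (norm (Z *v b))\<^sup>2 / (1 + g))
      + (1 + 1 / g) * (norm (Z *v (x - (g / (1 + g)) *\<^sub>R b)))\<^sup>2"
proof -
  define u v where "u = Z *v b" and "v = Z *v x"
  have o: "vec 1 \<bullet> u = 0" "vec 1 \<bullet> v = 0" "u \<bullet> vec 1 = 0" "v \<bullet> vec 1 = 0"
    "r \<bullet> u = 0" "r \<bullet> v = 0" "u \<bullet> r = 0" "v \<bullet> r = 0" "r \<bullet> vec 1 = 0" "vec 1 \<bullet> r = 0"
    using Z1 r1 rZ by (auto simp: u_def v_def inner_commute)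
  have e1: "y - (al *\<^sub>R vec 1 + v) = (c - al) *\<^sub>R vec 1 + (u - v) + r"
    by (simp add: y u_def v_def algebra_simps)
  have e2: "(norm ((c - al) *\<^sub>R vec 1 + (u - v) + r))\<^sup>2
      = (c - al)\<^sup>2 * (norm (vec 1 :: real^'n))\<^sup>2 + (norm (u - v))\<^sup>2 + (norm r)\<^sup>2"
    unfolding power2_norm_eq_inner by (simp add: inner_add_left inner_add_right inner_diff_left
        inner_diff_right o o[simplified] power2_eq_square)
  have e3: "Z *v (x - (g / (1 + g)) *\<^sub>R b) = v - (g / (1 + g)) *\<^sub>R u"
    by (simp add: u_def v_def matrix_vector_mult_diff_distrib matrix_vector_mult_scaleR)
  \<comment> \<open>Comparison of coefficients: the cross term has
    \<open>(1 + 1 / g) * (g / (1 + g)) = 1\<close>, and the square of \<open>u\<close> has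
    \<open>1 / (1 + g) + g / (1 + g) = 1\<close>.\<close>
  have e4: "(norm (u - v))\<^sup>2 + (norm v)\<^sup>2 / g
      = (norm u)\<^sup>2 / (1 + g) + (1 + 1 / g) * (norm (v - (g / (1 + g)) *\<^sub>R u))\<^sup>2"
  proof -
    have "1 + g \<noteq> 0" using g by simp
    then show ?thesis
      unfolding power2_norm_eq_inner using g
      by (simp add: inner_diff_left inner_diff_right inner_commute[of v u] divide_simps) algebra
  qed
  show ?thesis
    unfolding v_def[symmetric] u_def[symmetric] e1 e2 e3 norm_vec_1 using e4 by simp
qed

text \<open>The integrals are carried out from the inside out: slope, intercept, variance. The
  result is grouped for the Bayes factor: a factor common to all models, a factor depending only on
  \<open>Z\<close>, and the integral over \<open>g\<close> carrying the data.\<close>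

lemma marglik_eq:
  fixes Z :: "real^'k^'n" and r :: "real^'n"
  assumes inj: "inj ((*v) Z)" and a: "a > 2"
    and y: "y = c *\<^sub>R vec 1 + Z *v b + r"
    and Z1: "\<And>x. vec 1 \<bullet> (Z *v x) = 0" and r1: "vec 1 \<bullet> r = 0" and rZ: "\<And>x. r \<bullet> (Z *v x) = 0"
    and T: "T = (norm r)\<^sup>2 + (norm (Z *v b))\<^sup>2" "T > 0"
    and m: "m = (real CARD('n) - 1) / 2"
  shows "marglik Z a y =
    (ennreal ((2 * pi) powr (- real CARD('n) / 2) * ((a - 2) / 2))
      * variance_mass m * intercept_mass (real CARD('n)))
    * (ennreal ((2 * pi) powr (- real CARD('k) / 2) / sqrt (det (matrix_inv (transpose Z ** Z)))) * slope_mass Z)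
    * (\<integral>\<^sup>+g\<in>{0<..}. ennreal ((1 + g) powr (m - a / 2 - real CARD('k) / 2)
        * (T + g * (norm r)\<^sup>2) powr (- m)) \<partial>lborel)"
proof -
  let ?n = "real CARD('n)" and ?k = "real CARD('k)"
  define K1 where "K1 = (2 * pi) powr (- ?n / 2)"
  define K2 where "K2 = (2 * pi) powr (- ?k / 2) / sqrt (det (matrix_inv (transpose Z ** Z)))"
  have K: "K1 \<ge> 0" "K2 \<ge> 0"
    using det_inv_gram_pos[OF inj] by (auto simp: K1_def K2_def)
  define h where "h = hyperg_density a"
  have h: "h g \<ge> 0" for g using a by (simp add: h_def hyperg_density_def)
  \<comment> \<open>The part of the completed square free of slope and intercept: the residual sum
    of squares after shrinkage, which becomes the scale of the inverse-gamma integral over the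
    variance.\<close>
  define A where "A g = (norm r)\<^sup>2 + (norm (Z *v b))\<^sup>2 / (1 + g)" for g
  have A_eq: "A g = (T + g * (norm r)\<^sup>2) / (1 + g)" if "g > 0" for g
    using that by (simp add: A_def T field_simps)
  have A: "A g > 0" if "g > 0" for g
    using that T(2) by (simp add: A_eq add_pos_nonneg)
  define f where "f g s al x =
      mvn_density (al *\<^sub>R vec 1 + Z *v x) (s *\<^sub>R mat 1) y
        * mvn_density 0 ((g * s) *\<^sub>R matrix_inv (transpose Z ** Z)) x * (1 / s) * h g" for g s al x
  define C where "C g s = K1 * K2 * h g * (1 + g) powr (- ?k / 2) * (s powr (- ?n / 2 - 1) * exp (- A g / (2 * s)))" for g s
  have C: "C g s \<ge> 0" for g s using K h by (simp add: C_def)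
  have slope: "(\<integral>\<^sup>+x. ennreal (f g s al x) \<partial>lborel)
      = ennreal (C g s) * slope_mass Z * ennreal (exp (- (?n * (c - al)\<^sup>2) / (2 * s)))"
    if g: "g > 0" and s: "s > 0" for g s al
  proof -
    \<comment> \<open>Posterior precision of the slope relative to the Gram matrix: likelihood and
      prior contribute \<open>1 / s\<close> and \<open>1 / (g * s)\<close>.\<close>
    define q where "q = (1 + 1 / g) / s"
    have q: "q > 0" using g s by (simp add: q_def add_pos_pos)
    define b0 where "b0 = (g / (1 + g)) *\<^sub>R b"
    define D where "D = K1 * K2 * h g * (s powr (- ?n / 2) * (g * s) powr (- ?k / 2) * (1 / s))
      * exp (- A g / (2 * s)) * exp (- (?n * (c - al)\<^sup>2) / (2 * s))"
    have D: "D \<ge> 0" using K h s by (simp add: D_def)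
    have "f g s al x = D * exp (- (q * (norm (Z *v (x - b0)))\<^sup>2) / 2)" for x
    proof -
      have "- (norm (y - (al *\<^sub>R vec 1 + Z *v x)))\<^sup>2 / (2 * s) + - (norm (Z *v x))\<^sup>2 / (2 * (g * s))
          = - ((norm (y - (al *\<^sub>R vec 1 + Z *v x)))\<^sup>2 + (norm (Z *v x))\<^sup>2 / g) / (2 * s)"
        using g s by (simp add: field_simps)
      also have "\<dots> = - A g / (2 * s) + - (?n * (c - al)\<^sup>2) / (2 * s) + - (q * (norm (Z *v (x - b0)))\<^sup>2) / 2"
        unfolding residual_decomposition[OF y Z1 r1 rZ g] b0_def[symmetric] A_def[symmetric] q_def
        using s g by (simp add: field_simps)
      finally have E: "exp (- (norm (y - (al *\<^sub>R vec 1 + Z *v x)))\<^sup>2 / (2 * s)) * exp (- (norm (Z *v x))\<^sup>2 / (2 * (g * s)))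
          = exp (- A g / (2 * s)) * exp (- (?n * (c - al)\<^sup>2) / (2 * s)) * exp (- (q * (norm (Z *v (x - b0)))\<^sup>2) / 2)"
        by (simp only: exp_add[symmetric])
      have "f g s al x = K1 * K2 * h g * (s powr (- ?n / 2) * (g * s) powr (- ?k / 2) * (1 / s))
          * (exp (- (norm (y - (al *\<^sub>R vec 1 + Z *v x)))\<^sup>2 / (2 * s)) * exp (- (norm (Z *v x))\<^sup>2 / (2 * (g * s))))"
        unfolding f_def mvn_density_sampling[OF s] mvn_density_prior[OF inj mult_pos_pos[OF g s]]
          K1_def[symmetric] K2_def[symmetric]
        by (simp only: mult.assoc mult.commute mult.left_commute)
      then show ?thesis
        unfolding E D_def by (simp only: mult.assoc)
    qed
    then have "(\<integral>\<^sup>+x. ennreal (f g s al x) \<partial>lborel)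
        = (\<integral>\<^sup>+x. ennreal D * ennreal (exp (- (q * (norm (Z *v (x - b0)))\<^sup>2) / 2)) \<partial>lborel)"
      using D by (simp add: ennreal_mult)
    also have "\<dots> = ennreal D * (ennreal (q powr (- ?k / 2)) * slope_mass Z)"
      unfolding nn_integral_slope[OF q, where Z = Z and mu = b0, symmetric] by (rule nn_integral_cmult) measurable
    also have "\<dots> = ennreal (D * q powr (- ?k / 2)) * slope_mass Z"
      using D by (simp add: ennreal_mult mult.assoc)
    also have "D * q powr (- ?k / 2) = C g s * exp (- (?n * (c - al)\<^sup>2) / (2 * s))"
    proof -
      \<comment> \<open>Prior scale and posterior precision multiply to \<open>1 + g\<close>. This
        yields the factor \<open>(1 + g) powr (- ?k / 2)\<close> that penalises the number of
        columns.\<close>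
      have "(g * s) powr (- ?k / 2) * q powr (- ?k / 2) = (g * s * q) powr (- ?k / 2)"
        using g s q by (simp add: powr_mult)
      also have "g * s * q = 1 + g" using g s by (simp add: q_def field_simps)
      finally have 1: "(g * s) powr (- ?k / 2) * q powr (- ?k / 2) = (1 + g) powr (- ?k / 2)" .
      have 2: "s powr (- ?n / 2) * (1 / s) = s powr (- ?n / 2 - 1)"
        using s by (simp add: powr_diff)
      show ?thesis
        unfolding C_def D_def 1[symmetric] 2[symmetric] by (simp only: mult_ac)
    qed
    finally show ?thesis using C by (simp add: ennreal_mult mult_ac)
  qed
  have intercept: "(\<integral>\<^sup>+al. (\<integral>\<^sup>+x. ennreal (f g s al x) \<partial>lborel) \<partial>lborel)
      = ennreal (K1 * K2 * h g * (1 + g) powr (- ?k / 2)) * slope_mass Z * intercept_mass ?n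
        * ennreal (s powr (- m - 1) * exp (- A g / (2 * s)))"
    if g: "g > 0" and s: "s > 0" for g s
  proof -
    have "(\<integral>\<^sup>+al. (\<integral>\<^sup>+x. ennreal (f g s al x) \<partial>lborel) \<partial>lborel)
        = ennreal (C g s) * slope_mass Z * (ennreal (s powr (1 / 2)) * intercept_mass ?n)"
      unfolding slope[OF g s] nn_integral_intercept[OF s, where c = c, symmetric]
      by (rule nn_integral_cmult) measurable
    also have "\<dots> = ennreal (C g s * s powr (1 / 2)) * slope_mass Z * intercept_mass ?n"
      using C by (simp add: ennreal_mult mult_ac)
    also have "C g s * s powr (1 / 2) = K1 * K2 * h g * (1 + g) powr (- ?k / 2)
        * (s powr (- m - 1) * exp (- A g / (2 * s)))"
    proof -
      \<comment> \<open>The half power gained from the intercept lowers \<open>n\<close> to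
        \<open>n - 1\<close>, the degrees of freedom behind \<open>m\<close>.\<close>
      have "s powr (- ?n / 2 - 1) * s powr (1 / 2) = s powr (- m - 1)"
        by (simp add: m powr_add[symmetric] diff_divide_distrib)
      then show ?thesis unfolding C_def by (simp add: mult_ac)
    qed
    finally show ?thesis using K h by (simp add: ennreal_mult mult_ac)
  qed
  have variance: "(\<integral>\<^sup>+s\<in>{0<..}. (\<integral>\<^sup>+al. (\<integral>\<^sup>+x. ennreal (f g s al x) \<partial>lborel) \<partial>lborel) \<partial>lborel)
      = (ennreal (K1 * ((a - 2) / 2)) * variance_mass m * intercept_mass ?n) * (ennreal K2 * slope_mass Z)
        * ennreal ((1 + g) powr (m - a / 2 - ?k / 2) * (T + g * (norm r)\<^sup>2) powr (- m))"
    if g: "g > 0" for g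
  proof -
    have "(\<integral>\<^sup>+s\<in>{0<..}. (\<integral>\<^sup>+al. (\<integral>\<^sup>+x. ennreal (f g s al x) \<partial>lborel) \<partial>lborel) \<partial>lborel)
        = (\<integral>\<^sup>+s. ennreal (K1 * K2 * h g * (1 + g) powr (- ?k / 2)) * slope_mass Z * intercept_mass ?n
        * (ennreal (s powr (- m - 1) * exp (- A g / (2 * s))) * indicator {0<..} s) \<partial>lborel)"
      using g by (intro nn_integral_cong) (auto simp: indicator_def intercept mult_ac)
    also have "\<dots> = ennreal (K1 * K2 * h g * (1 + g) powr (- ?k / 2)) * slope_mass Z * intercept_mass ?n
        * (ennreal (A g powr (- m)) * variance_mass m)"
      unfolding nn_integral_variance[OF A[OF g], symmetric] by (rule nn_integral_cmult) measurable
    also have "\<dots> = ennreal (K1 * K2 * h g * (1 + g) powr (- ?k / 2) * A g powr (- m))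
        * slope_mass Z * intercept_mass ?n * variance_mass m"
      using K h by (simp add: ennreal_mult mult_ac)
    also have "K1 * K2 * h g * (1 + g) powr (- ?k / 2) * A g powr (- m)
        = K1 * ((a - 2) / 2) * K2 * ((1 + g) powr (m - a / 2 - ?k / 2) * (T + g * (norm r)\<^sup>2) powr (- m))"
    proof -
      have 1: "A g powr (- m) = (T + g * (norm r)\<^sup>2) powr (- m) * (1 + g) powr m"
        using g T(2) by (simp add: A_eq powr_divide powr_minus_divide)
      have 2: "(1 + g) powr (- a / 2) * (1 + g) powr (- ?k / 2) * (1 + g) powr m
          = (1 + g) powr (m - a / 2 - ?k / 2)"
        by (simp add: powr_add[symmetric] algebra_simps)
      show ?thesis
        unfolding h_def hyperg_density_def 1 2[symmetric] by (simp only: mult_ac)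
    qed
    also have "ennreal (K1 * ((a - 2) / 2) * K2 * ((1 + g) powr (m - a / 2 - ?k / 2) * (T + g * (norm r)\<^sup>2) powr (- m)))
        = ennreal (K1 * ((a - 2) / 2)) * ennreal K2
          * ennreal ((1 + g) powr (m - a / 2 - ?k / 2) * (T + g * (norm r)\<^sup>2) powr (- m))"
    proof -
      \<comment> \<open>Stated for opaque \<open>P\<close> and \<open>Q\<close> so that
        \<open>ennreal_mult\<close> splits the product at these two places only.\<close>
      have e: "ennreal (P * K2 * Q) = ennreal P * ennreal K2 * ennreal Q" if "P \<ge> 0" "Q \<ge> 0" for P Q
        using K that by (simp add: ennreal_mult)
      show ?thesis by (rule e) (use K a in simp_all)
    qed
    finally show ?thesis by (simp only: mult_ac)
  qed
  have "marglik Z a y = (\<integral>\<^sup>+g\<in>{0<..}. (\<integral>\<^sup>+s\<in>{0<..}. (\<integral>\<^sup>+al. (\<integral>\<^sup>+x. ennreal (f g s al x) \<partial>lborel) \<partial>lborel) \<partial>lborel) \<partial>lborel)"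
    by (simp add: marglik_def f_def h_def)
  also have "\<dots> = (\<integral>\<^sup>+g. (ennreal (K1 * ((a - 2) / 2)) * variance_mass m * intercept_mass ?n) * (ennreal K2 * slope_mass Z)
        * (ennreal ((1 + g) powr (m - a / 2 - ?k / 2) * (T + g * (norm r)\<^sup>2) powr (- m)) * indicator {0<..} g) \<partial>lborel)"
  proof (intro nn_integral_cong)
    fix g :: real
    show "(\<integral>\<^sup>+s\<in>{0<..}. (\<integral>\<^sup>+al. (\<integral>\<^sup>+x. ennreal (f g s al x) \<partial>lborel) \<partial>lborel) \<partial>lborel) * indicator {0<..} g
        = (ennreal (K1 * ((a - 2) / 2)) * variance_mass m * intercept_mass ?n) * (ennreal K2 * slope_mass Z)
        * (ennreal ((1 + g) powr (m - a / 2 - ?k / 2) * (T + g * (norm r)\<^sup>2) powr (- m)) * indicator {0<..} g)"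
    proof (cases "g > 0")
      case True
      show ?thesis unfolding variance[OF True] by (simp only: mult.assoc)
    qed simp
  qed
  also have "\<dots> = (ennreal (K1 * ((a - 2) / 2)) * variance_mass m * intercept_mass ?n) * (ennreal K2 * slope_mass Z)
      * (\<integral>\<^sup>+g\<in>{0<..}. ennreal ((1 + g) powr (m - a / 2 - ?k / 2) * (T + g * (norm r)\<^sup>2) powr (- m)) \<partial>lborel)"
    by (rule nn_integral_cmult) measurable
  finally show ?thesis
    unfolding K1_def K2_def .
qed

subsection \<open>Asymptotics of the integral over g\<close>

text \<open>At \<open>y = 0\<close> the assumption forces \<open>x = 0\<close>, and
  \<open>0 / 0 = 0\<close> in \<open>ennreal\<close>.\<close>

lemma ennreal_divide_le_of_le_mult:
  fixes x y :: ennreal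
  assumes "x \<le> c * y"
  shows "x / y \<le> c"
proof (cases "y = 0")
  case False
  then show ?thesis
    using assms by (intro divide_le_posI_ennreal) (auto simp: mult.commute zero_less_iff_neq_zero)
qed (use assms in simp)

text \<open>The multiplicative form of the assumption makes sense also where \<open>g x\<close> is
  zero or infinite.\<close>

lemma tendsto_zero_ennreal_divide:
  fixes f g :: "'a \<Rightarrow> ennreal"
  assumes "\<And>\<epsilon>. \<epsilon> > 0 \<Longrightarrow> eventually (\<lambda>x. f x \<le> ennreal \<epsilon> * g x) F"
  shows "((\<lambda>x. f x / g x) \<longlongrightarrow> 0) F"
proof (rule order_tendstoI)
  fix u :: ennreal
  assume "u > 0"
  \<comment> \<open>The intermediate \<open>v\<close> is finite even if \<open>u\<close> is not, and
    turns the non-strict bound into a strict one.\<close>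
  then obtain v where v: "0 < v" "v < u" using dense by blast
  then obtain \<epsilon> where \<epsilon>: "v = ennreal \<epsilon>" "\<epsilon> > 0"
    by (cases v) (auto simp: ennreal_less_zero_iff)
  show "eventually (\<lambda>x. f x / g x < u) F"
    using assms[OF \<epsilon>(2)]
    by (rule eventually_mono) (use v \<epsilon> ennreal_divide_le_of_le_mult in \<open>blast intro: le_less_trans\<close>)
qed simp

text \<open>An integral of Gauss hypergeometric type, with \<open>T\<close> the total centered and
  \<open>S\<close> the residual sum of squares. It takes values in \<open>ennreal\<close> because it
  diverges for \<open>S = 0\<close>, \<open>T > 0\<close> and \<open>e >= -1\<close>.\<close>

definition hyperg_integral :: "real \<Rightarrow> real \<Rightarrow> real \<Rightarrow> real \<Rightarrow> ennreal" where
  "hyperg_integral e m T S = (\<integral>\<^sup>+g\<in>{0<..}. ennreal ((1 + g) powr e * (T + g * S) powr (- m)) \<partial>lborel)"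

text \<open>Up to \<open>L\<close> the base \<open>T + g * S\<close> is at most
  \<open>2 * T\<close>, and \<open>e >= -1\<close> bounds \<open>(1 + g) powr e\<close> below by
  \<open>1 / (1 + g)\<close>, whose integral is the logarithm. This logarithmic divergence is where
  the condition relating \<open>n\<close>, \<open>a\<close> and \<open>p1\<close> takes
  effect.\<close>

lemma hyperg_integral_lower:
  assumes e: "e \<ge> -1" and m: "m \<ge> 0" and T: "T > 0" and S: "S \<ge> 0" and L: "L \<ge> 0" "L * S \<le> T"
  shows "ennreal ((2 * T) powr (- m) * ln (1 + L)) \<le> hyperg_integral e m T S"
proof -
  have "(\<integral>\<^sup>+g. ennreal (1 / (1 + g)) * indicator {0..L} g \<partial>lborel) = ennreal (ln (1 + L) - ln (1 + 0))"
    by (rule nn_integral_FTC_Icc) (use L in \<open>auto intro!: derivative_eq_intros\<close>)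
  then have "ennreal ((2 * T) powr (- m) * ln (1 + L))
      = ennreal ((2 * T) powr (- m)) * (\<integral>\<^sup>+g. ennreal (1 / (1 + g)) * indicator {0..L} g \<partial>lborel)"
    using L by (simp add: ennreal_mult)
  also have "\<dots> = (\<integral>\<^sup>+g. ennreal ((2 * T) powr (- m)) * (ennreal (1 / (1 + g)) * indicator {0..L} g) \<partial>lborel)"
    by (rule nn_integral_cmult[symmetric]) measurable
  also have "\<dots> \<le> hyperg_integral e m T S"
    unfolding hyperg_integral_def
  \<comment> \<open>The integral of \<open>1 / (1 + g)\<close> was taken over a closed interval, the
    target over an open half-line; the null set \<open>g = 0\<close> is discarded.\<close>
  proof (rule nn_integral_mono_AE, rule AE_mp[OF AE_lborel_singleton[of 0]], rule AE_I2, rule impI)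
    fix g :: real
    assume "g \<noteq> 0"
    have "(2 * T) powr (- m) * (1 / (1 + g)) \<le> (1 + g) powr e * (T + g * S) powr (- m)" if "0 < g" "g \<le> L"
    proof -
      have "g * S \<le> L * S" using that S by (simp add: mult_right_mono)
      then have "T + g * S \<le> 2 * T" using L by simp
      moreover have "T + g * S > 0" using T S that by (simp add: add_pos_nonneg)
      ultimately have "(2 * T) powr (- m) \<le> (T + g * S) powr (- m)"
        using m by (intro powr_mono2') auto
      moreover have "1 / (1 + g) = (1 + g) powr (- 1)"
        using that by (simp add: powr_minus_divide)
      moreover have "(1 + g) powr (- 1) \<le> (1 + g) powr e"
        using that e by (intro powr_mono) auto
      ultimately show ?thesis
        by (metis mult.commute mult_mono powr_ge_zero)
    qed
    with \<open>g \<noteq> 0\<close> show "ennreal ((2 * T) powr (- m)) * (ennreal (1 / (1 + g)) * indicator {0..L} g)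
        \<le> ennreal ((1 + g) powr e * (T + g * S) powr (- m)) * indicator {0<..} g"
      by (cases "g \<in> {0..L}") (auto simp flip: ennreal_mult intro!: ennreal_leI)
  qed
  finally show ?thesis .
qed

lemma nn_integral_powr_tail_finite:
  assumes q: "q < -1"
  shows "(\<integral>\<^sup>+g\<in>{0<..}. ennreal ((1 + g) powr q) \<partial>lborel) < \<infinity>"
proof -
  have "((\<lambda>g. (1 + g) powr (q + 1) / (q + 1)) \<longlongrightarrow> 0 / (q + 1)) at_top"
    using q by (intro tendsto_divide tendsto_const tendsto_neg_powr filterlim_tendsto_add_at_top[OF tendsto_const]
        filterlim_ident) auto
  then have "(\<integral>\<^sup>+g. ennreal ((1 + g) powr q) * indicator {0..} g \<partial>lborel)
      = ennreal (0 / (q + 1) - (1 + 0) powr (q + 1) / (q + 1))"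
    by (intro nn_integral_FTC_atLeast)
      (use q in \<open>auto intro!: derivative_eq_intros simp: powr_diff\<close>)
  then have "(\<integral>\<^sup>+g. ennreal ((1 + g) powr q) * indicator {0..} g \<partial>lborel) < \<infinity>"
    by simp
  moreover have "(\<integral>\<^sup>+g\<in>{0<..}. ennreal ((1 + g) powr q) \<partial>lborel)
      \<le> (\<integral>\<^sup>+g. ennreal ((1 + g) powr q) * indicator {0..} g \<partial>lborel)"
    by (intro nn_integral_mono) (auto simp: indicator_def)
  ultimately show ?thesis by (rule le_less_trans[rotated])
qed

text \<open>The two models have different residual sums of squares. With
  \<open>c = max 1 (S / S')\<close> one has \<open>T + g * S <= c * (T + g * S')\<close>, so
  exchanging them costs a constant independent of \<open>T\<close>.\<close>

lemma hyperg_integral_mono_residual: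
  assumes m: "m \<ge> 0" and T: "T > 0" and S: "S \<ge> 0" "S' > 0"
  shows "hyperg_integral e m T S' \<le> ennreal (max 1 (S / S') powr m) * hyperg_integral e m T S"
proof -
  define c where "c = max 1 (S / S')"
  have c: "c \<ge> 1" "S \<le> c * S'" using S by (auto simp: c_def max_def field_simps)
  have "hyperg_integral e m T S' \<le> (\<integral>\<^sup>+g. ennreal (c powr m)
      * (ennreal ((1 + g) powr e * (T + g * S) powr (- m)) * indicator {0<..} g) \<partial>lborel)"
    unfolding hyperg_integral_def
  proof (rule nn_integral_mono)
    fix g :: real
    have "(1 + g) powr e * (T + g * S') powr (- m) \<le> c powr m * ((1 + g) powr e * (T + g * S) powr (- m))"
      if g: "g > 0"
    proof -
      have pos: "T + g * S > 0" "T + g * S' > 0" using T S g by (auto simp: add_pos_nonneg)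
      have "g * S \<le> g * (c * S')" using c g by simp
      moreover have "T \<le> c * T" using c T by simp
      ultimately have "T + g * S \<le> c * (T + g * S')" by (simp add: algebra_simps)
      then have "(c * (T + g * S')) powr (- m) \<le> (T + g * S) powr (- m)"
        using m pos by (intro powr_mono2') auto
      then have "c powr m * (c powr (- m) * (T + g * S') powr (- m)) \<le> c powr m * (T + g * S) powr (- m)"
        using c pos by (simp add: powr_mult mult_left_mono)
      moreover have "c powr m * c powr (- m) = 1"
        using c by (simp add: powr_add[symmetric])
      ultimately have "(T + g * S') powr (- m) \<le> c powr m * (T + g * S) powr (- m)"
        by (simp add: mult.assoc[symmetric])
      from mult_left_mono[OF this, of "(1 + g) powr e"] show ?thesis
        by (simp add: mult.left_commute)
    qed
    then show "ennreal ((1 + g) powr e * (T + g * S') powr (- m)) * indicator {0<..} g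
        \<le> ennreal (c powr m) * (ennreal ((1 + g) powr e * (T + g * S) powr (- m)) * indicator {0<..} g)"
      by (cases "g > 0") (auto simp flip: ennreal_mult intro!: ennreal_leI)
  qed
  also have "\<dots> = ennreal (c powr m) * hyperg_integral e m T S"
    unfolding hyperg_integral_def by (rule nn_integral_cmult) measurable
  finally show ?thesis by (simp add: c_def)
qed

text \<open>The range is cut at \<open>M\<close>: below, the integrand is at most a constant times
  \<open>T powr (- m)\<close>, where the absolute value covers both signs of \<open>e - d\<close>;
  above, the extra factor \<open>(1 + g) powr (- d)\<close> is at most its value at
  \<open>M\<close>.\<close>

lemma hyperg_integral_split:
  assumes m: "m \<ge> 0" and d: "d \<ge> 0" and T: "T > 0" and S: "S \<ge> 0" and M: "M \<ge> 0"
  shows "hyperg_integral (e - d) m T S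
    \<le> ennreal ((1 + M) powr \<bar>e - d\<bar> * M * T powr (- m)) + ennreal ((1 + M) powr (- d)) * hyperg_integral e m T S"
proof -
  let ?c = "(1 + M) powr \<bar>e - d\<bar> * T powr (- m)"
  let ?f = "\<lambda>g. ennreal ((1 + g) powr e * (T + g * S) powr (- m)) * indicator {0<..} g"
  have "hyperg_integral (e - d) m T S
      \<le> (\<integral>\<^sup>+g. ennreal ?c * indicator {0..M} g + ennreal ((1 + M) powr (- d)) * ?f g \<partial>lborel)"
    unfolding hyperg_integral_def
  proof (rule nn_integral_mono)
    fix g :: real
    consider "g \<le> 0" | "0 < g" "g \<le> M" | "0 < g" "M < g" by linarith
    then show "ennreal ((1 + g) powr (e - d) * (T + g * S) powr (- m)) * indicator {0<..} g
        \<le> ennreal ?c * indicator {0..M} g + ennreal ((1 + M) powr (- d)) * ?f g"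
    proof cases
      case 2
      have "(1 + g) powr (e - d) \<le> (1 + g) powr \<bar>e - d\<bar>"
        using 2 by (intro powr_mono) auto
      also have "\<dots> \<le> (1 + M) powr \<bar>e - d\<bar>"
        using 2 by (intro powr_mono2) auto
      finally have "(1 + g) powr (e - d) \<le> (1 + M) powr \<bar>e - d\<bar>" .
      moreover have "(T + g * S) powr (- m) \<le> T powr (- m)"
        using 2 T S m by (intro powr_mono2') auto
      ultimately have "(1 + g) powr (e - d) * (T + g * S) powr (- m) \<le> ?c"
        by (intro mult_mono) auto
      then have "ennreal ((1 + g) powr (e - d) * (T + g * S) powr (- m)) \<le> ennreal ?c"
        by (rule ennreal_leI)
      then show ?thesis
        using 2 by (simp add: add_increasing2)
    next
      case 3
      have "(1 + g) powr (- d) \<le> (1 + M) powr (- d)"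
        using 3 M d by (intro powr_mono2') auto
      then have "(1 + g) powr (- d) * ((1 + g) powr e * (T + g * S) powr (- m))
          \<le> (1 + M) powr (- d) * ((1 + g) powr e * (T + g * S) powr (- m))"
        by (intro mult_right_mono) auto
      moreover have "(1 + g) powr (- d) * (1 + g) powr e = (1 + g) powr (e - d)"
        by (simp add: powr_add[symmetric])
      ultimately have "(1 + g) powr (e - d) * (T + g * S) powr (- m)
          \<le> (1 + M) powr (- d) * ((1 + g) powr e * (T + g * S) powr (- m))"
        by (simp add: mult.assoc[symmetric])
      from ennreal_leI[OF this] show ?thesis
        using 3 by (simp add: ennreal_mult)
    qed simp
  qed
  also have "\<dots> = (\<integral>\<^sup>+g. ennreal ?c * indicator {0..M} g \<partial>lborel)
      + (\<integral>\<^sup>+g. ennreal ((1 + M) powr (- d)) * ?f g \<partial>lborel)"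
    by (rule nn_integral_add) measurable
  also have "(\<integral>\<^sup>+g. ennreal ?c * indicator {0..M} g \<partial>lborel) = ennreal ?c * ennreal M"
    using M by (simp add: nn_integral_cmult_indicator)
  also have "\<dots> = ennreal ((1 + M) powr \<bar>e - d\<bar> * M * T powr (- m))"
    using M by (simp add: ennreal_mult mult_ac)
  also have "(\<integral>\<^sup>+g. ennreal ((1 + M) powr (- d)) * ?f g \<partial>lborel)
      = ennreal ((1 + M) powr (- d)) * hyperg_integral e m T S"
    unfolding hyperg_integral_def by (rule nn_integral_cmult) measurable
  finally show ?thesis .
qed

text \<open>Dropping \<open>g * S\<close> separates \<open>T\<close> from the integral; this serves
  the case of a vanishing residual, with \<open>q < -1\<close>.\<close>

lemma hyperg_integral_upper:
  assumes m: "m \<ge> 0" and T: "T > 0" and S: "S \<ge> 0"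
  shows "hyperg_integral q m T S \<le> ennreal (T powr (- m)) * (\<integral>\<^sup>+g\<in>{0<..}. ennreal ((1 + g) powr q) \<partial>lborel)"
proof -
  have "hyperg_integral q m T S
      \<le> (\<integral>\<^sup>+g. ennreal (T powr (- m)) * (ennreal ((1 + g) powr q) * indicator {0<..} g) \<partial>lborel)"
    unfolding hyperg_integral_def
  proof (rule nn_integral_mono)
    fix g :: real
    have "(1 + g) powr q * (T + g * S) powr (- m) \<le> T powr (- m) * (1 + g) powr q" if "g > 0"
    proof -
      have "(T + g * S) powr (- m) \<le> T powr (- m)"
        using that T S m by (intro powr_mono2') auto
      from mult_left_mono[OF this, of "(1 + g) powr q"] show ?thesis
        by (simp add: mult.commute)
    qed
    then show "ennreal ((1 + g) powr q * (T + g * S) powr (- m)) * indicator {0<..} g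
        \<le> ennreal (T powr (- m)) * (ennreal ((1 + g) powr q) * indicator {0<..} g)"
      by (cases "g > 0") (auto simp flip: ennreal_mult intro!: ennreal_leI)
  qed
  also have "\<dots> = ennreal (T powr (- m)) * (\<integral>\<^sup>+g\<in>{0<..}. ennreal ((1 + g) powr q) \<partial>lborel)"
    by (rule nn_integral_cmult) measurable
  finally show ?thesis .
qed

text \<open>The point is that \<open>K\<close> does not depend on \<open>T\<close>. For
  \<open>S' > 0\<close> the cut \<open>M\<close> is taken so large that the tail factor absorbs the
  constant \<open>c\<close> for exchanging residuals; otherwise \<open>e - d < -1\<close> and the
  whole integral is of order \<open>T powr (- m)\<close>.\<close>

lemma hyperg_integral_bound:
  assumes m: "m \<ge> 0" and d: "d > 0" and S: "S \<ge> 0" "S' \<ge> 0"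
    and nondeg: "S' > 0 \<or> e - d < -1" and \<delta>: "\<delta> > 0"
  obtains K where "K \<ge> 0"
    "\<And>T. T > 0 \<Longrightarrow> hyperg_integral (e - d) m T S' \<le> ennreal (K * T powr (- m)) + ennreal \<delta> * hyperg_integral e m T S"
proof (cases "S' > 0")
  case True
  define c where "c = max 1 (S / S') powr m"
  have c: "c > 0" by (simp add: c_def)
  have "((\<lambda>M. (1 + M) powr (- d)) \<longlongrightarrow> 0) at_top"
    using d by (intro tendsto_neg_powr filterlim_tendsto_add_at_top[OF tendsto_const] filterlim_ident) auto
  then have "eventually (\<lambda>M. (1 + M) powr (- d) < \<delta> / c) at_top"
    by (rule order_tendstoD) (use c \<delta> in simp)
  then have "eventually (\<lambda>M. M \<ge> 0 \<and> (1 + M) powr (- d) < \<delta> / c) at_top"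
    using eventually_ge_at_top[of 0] by eventually_elim simp
  from eventually_happens'[OF trivial_limit_at_top_linorder this]
  obtain M where M: "M \<ge> 0" "(1 + M) powr (- d) < \<delta> / c" by auto
  have Mc: "(1 + M) powr (- d) * c \<le> \<delta>"
    using M(2) c by (simp add: field_simps)
  show ?thesis
  proof
    show "(1 + M) powr \<bar>e - d\<bar> * M \<ge> 0" using M by simp
    fix T :: real
    assume T: "T > 0"
    have "ennreal ((1 + M) powr (- d)) * hyperg_integral e m T S'
        \<le> ennreal ((1 + M) powr (- d)) * (ennreal c * hyperg_integral e m T S)"
      using hyperg_integral_mono_residual[OF m T S(1) True] by (intro mult_left_mono) (auto simp: c_def)
    also have "\<dots> = ennreal ((1 + M) powr (- d) * c) * hyperg_integral e m T S"
      using c by (simp add: ennreal_mult mult.assoc)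
    also have "\<dots> \<le> ennreal \<delta> * hyperg_integral e m T S"
      using Mc by (intro mult_right_mono ennreal_leI) auto
    finally show "hyperg_integral (e - d) m T S'
        \<le> ennreal ((1 + M) powr \<bar>e - d\<bar> * M * T powr (- m)) + ennreal \<delta> * hyperg_integral e m T S"
      using hyperg_integral_split[OF m less_imp_le[OF d] T S(2) M(1), of e]
      by (blast intro: add_left_mono order_trans)
  qed
next
  case False
  then have "e - d < -1" using nondeg by simp
  from nn_integral_powr_tail_finite[OF this]
  obtain K where K: "K \<ge> 0" "(\<integral>\<^sup>+g\<in>{0<..}. ennreal ((1 + g) powr (e - d)) \<partial>lborel) = ennreal K"
    by (cases "\<integral>\<^sup>+g\<in>{0<..}. ennreal ((1 + g) powr (e - d)) \<partial>lborel") auto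
  show ?thesis
  proof
    show "K \<ge> 0" by (rule K)
    fix T :: real
    assume T: "T > 0"
    have "hyperg_integral (e - d) m T S' \<le> ennreal (K * T powr (- m))"
      using hyperg_integral_upper[OF m T S(2), of "e - d"] K by (simp add: ennreal_mult mult.commute)
    then show "hyperg_integral (e - d) m T S' \<le> ennreal (K * T powr (- m)) + ennreal \<delta> * hyperg_integral e m T S"
      by (simp add: add_increasing2)
  qed
qed

lemma hyperg_integral_eventually_small:
  fixes T :: "'a \<Rightarrow> real"
  assumes e: "e \<ge> -1" and m: "m \<ge> 0" and d: "d > 0" and S: "S \<ge> 0" "S' \<ge> 0"
    and nondeg: "S' > 0 \<or> e - d < -1" and T: "filterlim T at_top F" and \<epsilon>: "\<epsilon> > 0"
  shows "eventually (\<lambda>N. hyperg_integral (e - d) m (T N) S' \<le> ennreal \<epsilon> * hyperg_integral e m (T N) S) F"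
proof -
  have \<epsilon>2: "\<epsilon> / 2 > 0" using \<epsilon> by simp
  obtain K where K: "K \<ge> 0" "\<And>T. T > 0 \<Longrightarrow> hyperg_integral (e - d) m T S'
      \<le> ennreal (K * T powr (- m)) + ennreal (\<epsilon> / 2) * hyperg_integral e m T S"
    using hyperg_integral_bound[OF m d S nondeg \<epsilon>2] by blast
  \<comment> \<open>Solves \<open>K * 2 powr m = \<epsilon> / 2 * ln (1 + L)\<close>, so that the
    lower bound for the smaller model at this fixed \<open>L\<close> absorbs
    \<open>K * T powr (- m)\<close>. It applies once \<open>T\<close> exceeds
    \<open>L * S\<close>.\<close>
  define L where "L = exp (K * 2 powr m / (\<epsilon> / 2)) - 1"
  have L: "L \<ge> 0" "K * 2 powr m = \<epsilon> / 2 * ln (1 + L)"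
    using K(1) \<epsilon> by (auto simp: L_def)
  have "eventually (\<lambda>N. T N \<ge> max 1 (L * S)) F"
    using T unfolding filterlim_at_top by blast
  then show ?thesis
  proof eventually_elim
    case (elim N)
    then have TN: "T N > 0" "L * S \<le> T N" by auto
    have "K * T N powr (- m) = K * 2 powr m * (2 * T N) powr (- m)"
      using TN by (simp add: powr_mult powr_minus_divide)
    also have "\<dots> = \<epsilon> / 2 * ((2 * T N) powr (- m) * ln (1 + L))"
      unfolding L(2) by simp
    finally have K_eq: "K * T N powr (- m) = \<epsilon> / 2 * ((2 * T N) powr (- m) * ln (1 + L))" .
    have "ennreal (K * T N powr (- m)) = ennreal (\<epsilon> / 2) * ennreal ((2 * T N) powr (- m) * ln (1 + L))"
      unfolding K_eq by (rule ennreal_mult) (use \<epsilon> L in simp_all)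
    also have "\<dots> \<le> ennreal (\<epsilon> / 2) * hyperg_integral e m (T N) S"
      by (intro mult_left_mono hyperg_integral_lower e m TN S L) simp
    finally have "hyperg_integral (e - d) m (T N) S'
        \<le> ennreal (\<epsilon> / 2) * hyperg_integral e m (T N) S + ennreal (\<epsilon> / 2) * hyperg_integral e m (T N) S"
      using K(2)[OF TN(1)] by (blast intro: add_right_mono order_trans)
    also have "\<dots> = (ennreal (\<epsilon> / 2) + ennreal (\<epsilon> / 2)) * hyperg_integral e m (T N) S"
      by (simp only: distrib_right)
    also have "ennreal (\<epsilon> / 2) + ennreal (\<epsilon> / 2) = ennreal \<epsilon>"
      using \<epsilon> by (simp flip: ennreal_plus)
    finally show ?case .
  qed
qed

subsection \<open>Regression decompositions and the Bayes factor\<close>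

definition join_vec :: "real^'p \<Rightarrow> real^'q \<Rightarrow> real^('p + 'q)" where
  "join_vec u v = (\<chi> j. case j of Inl k \<Rightarrow> u $ k | Inr k \<Rightarrow> v $ k)"

lemma concat_cols_mult_join:
  fixes X1 :: "real^'p^'n" and X2 :: "real^'q^'n"
  shows "concat_cols X1 X2 *v join_vec u v = X1 *v u + X2 *v v"
proof -
  have "(\<Sum>j\<in>UNIV. f j) = (\<Sum>k\<in>UNIV. f (Inl k)) + (\<Sum>k\<in>UNIV. f (Inr k))"
    for f :: "'p + 'q \<Rightarrow> real"
    using sum.Plus[of "UNIV :: 'p set" "UNIV :: 'q set" f] by simp
  then show ?thesis
    by (simp add: vec_eq_iff matrix_vector_mult_def concat_cols_def join_vec_def)
qed

lemma inner_vec_1_matrix_mult: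
  fixes Z :: "real^'k^'n"
  assumes "\<forall>j. (\<Sum>i\<in>UNIV. Z $ i $ j) = 0"
  shows "vec 1 \<bullet> (Z *v x) = 0"
proof -
  have "vec 1 \<bullet> (Z *v x) = (\<Sum>i\<in>UNIV. \<Sum>j\<in>UNIV. Z $ i $ j * x $ j)"
    by (simp add: inner_vec_def matrix_vector_mult_def)
  also have "\<dots> = (\<Sum>j\<in>UNIV. (\<Sum>i\<in>UNIV. Z $ i $ j) * x $ j)"
    by (subst sum.swap) (simp add: sum_distrib_right)
  finally show ?thesis using assms by simp
qed

text \<open>Orthogonal projection onto the span of the intercept vector and the columns of
  \<open>Z\<close>.\<close>

lemma regression_decomposition:
  fixes Z :: "real^'k^'n" and v :: "real^'n"
  obtains c b r where "v = c *\<^sub>R vec 1 + Z *v b + r" "vec 1 \<bullet> r = 0" "\<And>x. r \<bullet> (Z *v x) = 0"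
proof -
  let ?S = "insert (vec 1) (columns Z)"
  obtain u r where u: "u \<in> span ?S" and r: "\<And>w. w \<in> span ?S \<Longrightarrow> orthogonal r w" and v: "v = u + r"
    using orthogonal_subspace_decomp_exists by blast
  obtain c where "u - c *\<^sub>R vec 1 \<in> span (columns Z)"
    using u by (auto simp: span_breakdown_eq)
  moreover have "span (columns Z) \<subseteq> range ((*v) Z)"
    by (intro span_minimal linear_subspace_image subspace_UNIV matrix_vector_mul_linear)
      (auto simp: columns_image_basis)
  ultimately obtain b where "u - c *\<^sub>R vec 1 = Z *v b" by blast
  then have "v = c *\<^sub>R vec 1 + Z *v b + r" by (simp add: v algebra_simps)
  moreover have "vec 1 \<bullet> r = 0"
    using r[of "vec 1"] by (simp add: span_base orthogonal_def inner_commute)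
  moreover have "r \<bullet> (Z *v x) = 0" for x
  proof -
    have "Z *v x \<in> span ?S"
      using matrix_vector_mult_in_columnspace span_mono[of "columns Z" ?S] by blast
    then show ?thesis using r by (simp add: orthogonal_def)
  qed
  ultimately show ?thesis using that by blast
qed

text \<open>Pythagoras. The right-hand side is free of \<open>Z\<close>, so both models share the
  same \<open>T\<close>.\<close>

lemma centered_sum_of_squares:
  fixes Z :: "real^'k^'n" and r :: "real^'n"
  assumes y: "y = c *\<^sub>R vec 1 + Z *v b + r"
    and Z1: "\<And>x. vec 1 \<bullet> (Z *v x) = 0" and r1: "vec 1 \<bullet> r = 0" and rZ: "\<And>x. r \<bullet> (Z *v x) = 0"
  shows "(norm r)\<^sup>2 + (norm (Z *v b))\<^sup>2 = (norm y)\<^sup>2 - (vec 1 \<bullet> y)\<^sup>2 / real CARD('n)"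
proof -
  define e :: "real^'n" where "e = vec 1"
  have o: "e \<bullet> (Z *v b) = 0" "(Z *v b) \<bullet> e = 0" "e \<bullet> r = 0" "r \<bullet> e = 0"
    "r \<bullet> (Z *v b) = 0" "(Z *v b) \<bullet> r = 0"
    using Z1 r1 rZ by (simp_all only: e_def inner_commute)
  have n: "e \<bullet> e = real CARD('n)"
    unfolding e_def using norm_vec_1 by (simp only: power2_norm_eq_inner)
  have "e \<bullet> y = c * real CARD('n)"
    unfolding y e_def[symmetric] by (simp add: inner_add_right o n)
  moreover have "(norm y)\<^sup>2 = c\<^sup>2 * real CARD('n) + (norm (Z *v b))\<^sup>2 + (norm r)\<^sup>2"
    unfolding power2_norm_eq_inner y e_def[symmetric]
    by (simp add: inner_add_left inner_add_right o n power2_eq_square)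
  ultimately show ?thesis
    unfolding e_def by (simp add: power2_eq_square)
qed

text \<open>\<open>D\<close> is fixed before \<open>y\<close>, so one constant serves the whole
  sequence of data sets; it is also positive and finite, so it can be divided out.\<close>

lemma marglik_hyperg_integral:
  fixes Z :: "real^'k^'n"
  assumes inj: "inj ((*v) Z)" and a: "a > 2" and Z1: "\<And>x. vec 1 \<bullet> (Z *v x) = 0"
  obtains D where "D > 0"
    "\<And>y c b r. y = c *\<^sub>R vec 1 + Z *v b + r \<Longrightarrow> vec 1 \<bullet> r = 0 \<Longrightarrow> (\<And>x. r \<bullet> (Z *v x) = 0) \<Longrightarrow>
      (norm y)\<^sup>2 - (vec 1 \<bullet> y)\<^sup>2 / real CARD('n) > 0 \<Longrightarrow>
      marglik Z a y =
        (ennreal ((2 * pi) powr (- real CARD('n) / 2) * ((a - 2) / 2))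
          * variance_mass ((real CARD('n) - 1) / 2) * intercept_mass (real CARD('n)))
        * (ennreal D * hyperg_integral ((real CARD('n) - 1) / 2 - a / 2 - real CARD('k) / 2) ((real CARD('n) - 1) / 2)
            ((norm y)\<^sup>2 - (vec 1 \<bullet> y)\<^sup>2 / real CARD('n)) ((norm r)\<^sup>2))"
proof -
  let ?D = "ennreal ((2 * pi) powr (- real CARD('k) / 2) / sqrt (det (matrix_inv (transpose Z ** Z)))) * slope_mass Z"
  have "slope_mass Z < \<infinity>"
    unfolding slope_mass_def by (rule nn_integral_gaussian_linear_finite[OF inj])
  then have "?D < \<infinity>" by (simp add: ennreal_mult_less_top)
  then obtain D where D: "D \<ge> 0" "?D = ennreal D" by (cases ?D) auto
  have [measurable]: "(\<lambda>x. Z *v x) \<in> borel_measurable borel"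
    using borel_measurable_matrix_vector_mult_diff[of Z 0] by simp
  have "slope_mass Z \<noteq> 0"
  proof
    assume "slope_mass Z = 0"
    \<comment> \<open>A zero integral would make a positive function vanish almost everywhere,
      although Lebesgue measure is not zero.\<close>
    then have "AE x in lborel. ennreal (exp (- (norm (Z *v x))\<^sup>2 / 2)) = 0"
      unfolding slope_mass_def by (subst (asm) nn_integral_0_iff_AE) measurable
    then have "AE x :: real^'k in lborel. False" by simp
    then have "emeasure lborel (UNIV :: (real^'k) set) = 0"
      by (simp add: eventually_False ae_filter_eq_bot_iff)
    then show False by simp
  qed
  then have "?D \<noteq> 0"
    using det_inv_gram_pos[OF inj] by simp
  with D have "D > 0" by (auto simp: order_less_le)
  then show ?thesis
  proof (rule that)
    fix y c b r
    assume y: "y = c *\<^sub>R vec 1 + Z *v b + r" "vec 1 \<bullet> r = 0" "\<And>x. r \<bullet> (Z *v x) = 0"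
      "(norm y)\<^sup>2 - (vec 1 \<bullet> y)\<^sup>2 / real CARD('n) > 0"
    show "marglik Z a y =
        (ennreal ((2 * pi) powr (- real CARD('n) / 2) * ((a - 2) / 2))
          * variance_mass ((real CARD('n) - 1) / 2) * intercept_mass (real CARD('n)))
        * (ennreal D * hyperg_integral ((real CARD('n) - 1) / 2 - a / 2 - real CARD('k) / 2) ((real CARD('n) - 1) / 2)
            ((norm y)\<^sup>2 - (vec 1 \<bullet> y)\<^sup>2 / real CARD('n)) ((norm r)\<^sup>2))"
      unfolding D(2)[symmetric] hyperg_integral_def mult.assoc[symmetric]
      by (rule marglik_eq[OF inj a y(1) Z1 y(2,3) centered_sum_of_squares[OF y(1) Z1 y(2,3), symmetric] y(4) refl,
            unfolded mult.assoc[symmetric]])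
  qed
qed

text \<open>\<open>nondeg\<close> excludes the case in which the larger model fits
  \<open>eps\<close> perfectly while its integral over \<open>g\<close> diverges, making its
  marginal likelihood infinite.\<close>

theorem theorem3p2:
  fixes X1 :: "real^'p1^'n" and X2 :: "real^'p2^'n"
    and a alpha :: real and beta2 :: "real^'p2" and eps :: "real^'n"
    and beta1 :: "nat \<Rightarrow> real^'p1"
  assumes n_gt_p: "CARD('n) > CARD('p1) + CARD('p2)"
    and full_rank: "rank (concat_cols X1 X2) = CARD('p1) + CARD('p2)"
    and centered: "\<forall>j. (\<Sum>i\<in>UNIV. concat_cols X1 X2 $ i $ j) = 0"
    and a_gt: "a > 2"
    and n_ge: "real CARD('n) \<ge> a + real CARD('p1) - 1"
    and beta1_inf: "filterlim (\<lambda>N. norm (beta1 N)) at_top sequentially"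
    and nondeg: "eps \<notin> span (insert (vec 1) (columns (concat_cols X1 X2)))
                 \<or> real CARD('n) < a + real CARD('p1) + real CARD('p2) - 1"
  shows "((\<lambda>N. bayes_factor (concat_cols X1 X2) X1 a
            (alpha *\<^sub>R vec 1 + X1 *v beta1 N + X2 *v beta2 + eps)) \<longlongrightarrow> 0) sequentially"
proof -
  define X where "X = concat_cols X1 X2"
  define y where "y N = alpha *\<^sub>R vec 1 + X1 *v beta1 N + X2 *v beta2 + eps" for N
  define T where "T N = (norm (y N))\<^sup>2 - (vec 1 \<bullet> y N)\<^sup>2 / real CARD('n)" for N
  define m where "m = (real CARD('n) - 1) / 2"
  \<comment> \<open>The exponent of \<open>1 + g\<close> for the smaller model; \<open>n_ge\<close>
    says exactly that \<open>e >= -1\<close>. The larger model has \<open>e - d\<close>.\<close>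
  define e where "e = m - a / 2 - real CARD('p1) / 2"
  define d where "d = real CARD('p2) / 2"
  have X_join: "X *v join_vec u v = X1 *v u + X2 *v v" for u v
    unfolding X_def by (rule concat_cols_mult_join)
  have inj: "inj ((*v) X)"
    using full_rank by (simp add: X_def full_rank_injective[symmetric])
  have "u = 0" if "X1 *v u = 0" for u
  proof -
    have "X *v join_vec u 0 = 0" using that by (simp add: X_join)
    then have "join_vec u (0 :: real^'p2) = 0"
      using inj by (simp add: linear_injective_0[OF matrix_vector_mul_linear])
    then have "join_vec u (0 :: real^'p2) $ Inl k = 0" for k by simp
    then show ?thesis by (simp add: join_vec_def vec_eq_iff)
  qed
  then have inj1: "inj ((*v) X1)"
    by (simp add: linear_injective_0[OF matrix_vector_mul_linear])
  have Z: "vec 1 \<bullet> (X *v x) = 0" for x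
    unfolding X_def by (rule inner_vec_1_matrix_mult[OF centered])
  have Z1: "vec 1 \<bullet> (X1 *v x) = 0" for x
    using Z[of "join_vec x 0"] by (simp only: X_join matrix_vector_mult_0_right add_0_right)
  \<comment> \<open>Only the part of the data that does not move with \<open>N\<close> is
    decomposed, here and for \<open>eps\<close> below, so the residuals \<open>r1\<close> and
    \<open>r2\<close> are the same for every \<open>N\<close>.\<close>
  obtain c1 b1 r1 where v: "X2 *v beta2 + eps = c1 *\<^sub>R vec 1 + X1 *v b1 + r1"
    and r1: "vec 1 \<bullet> r1 = 0" "\<And>x. r1 \<bullet> (X1 *v x) = 0"
    by (rule regression_decomposition[of "X2 *v beta2 + eps" X1]) blast
  obtain c2 b2 r2 where eps: "eps = c2 *\<^sub>R vec 1 + X *v b2 + r2"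
    and r2: "vec 1 \<bullet> r2 = 0" "\<And>x. r2 \<bullet> (X *v x) = 0"
    by (rule regression_decomposition[of eps X]) blast
  have y1: "y N = (alpha + c1) *\<^sub>R vec 1 + X1 *v (beta1 N + b1) + r1" for N
    using v by (simp add: y_def matrix_vector_right_distrib scaleR_add_left add_ac)
  have y2: "y N = (alpha + c2) *\<^sub>R vec 1 + X *v (join_vec (beta1 N) beta2 + b2) + r2" for N
    unfolding y_def matrix_vector_right_distrib X_join scaleR_add_left by (subst eps) (simp only: add_ac)
  obtain B where B: "B > 0" "\<And>x. B * norm x \<le> norm (X1 *v x)"
    using linear_inj_bounded_below_pos[OF matrix_vector_mul_linear inj1] by blast
  have T_lower: "B * (norm (beta1 N) - norm b1) - 1 \<le> T N" for N
  proof -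
    have "B * (norm (beta1 N) - norm b1) \<le> B * norm (beta1 N + b1)"
      using B(1) norm_diff_ineq[of "beta1 N" b1] by simp
    also have "\<dots> \<le> norm (X1 *v (beta1 N + b1))" by (rule B)
    \<comment> \<open>The estimate \<open>t <= t^2 + 1\<close> for \<open>t >= 0\<close> gives a
      lower bound for \<open>T N\<close> that is linear in \<open>norm (beta1 N)\<close>.\<close>
    also have "\<dots> \<le> (norm (X1 *v (beta1 N + b1)))\<^sup>2 + 1"
      using zero_le_power2[of "norm (X1 *v (beta1 N + b1)) - 1"] norm_ge_zero[of "X1 *v (beta1 N + b1)"]
      unfolding power2_diff one_power2 by linarith
    also have "\<dots> \<le> T N + 1"
      using centered_sum_of_squares[OF y1 Z1 r1, of N] zero_le_power2[of "norm r1"]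
      unfolding T_def by linarith
    finally show ?thesis by simp
  qed
  have T_inf: "filterlim T at_top sequentially"
    unfolding filterlim_at_top
  proof
    fix K
    have "eventually (\<lambda>N. norm (beta1 N) \<ge> (K + 1) / B + norm b1) sequentially"
      using beta1_inf unfolding filterlim_at_top by blast
    then show "eventually (\<lambda>N. K \<le> T N) sequentially"
    proof eventually_elim
      case (elim N)
      then have "K + 1 \<le> B * (norm (beta1 N) - norm b1)"
        using B(1) by (simp add: field_simps)
      then show ?case using T_lower[of N] by simp
    qed
  qed
  have e: "e \<ge> -1" using n_ge by (simp add: e_def m_def field_simps)
  have m: "m \<ge> 0" by (simp add: m_def Suc_leI)
  have d: "d > 0" by (simp add: d_def)
  \<comment> \<open>\<open>e - d < -1\<close> is the second alternative of \<open>nondeg\<close>.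
    Failing that, \<open>r2 = 0\<close> would put \<open>eps\<close> into the excluded span.\<close>
  have S: "(norm r2)\<^sup>2 > 0 \<or> e - d < -1"
  proof (cases "real CARD('n) < a + real CARD('p1) + real CARD('p2) - 1")
    case True
    then show ?thesis by (simp add: e_def d_def m_def field_simps)
  next
    case False
    have "r2 \<noteq> 0"
    proof
      assume "r2 = 0"
      then have "eps - c2 *\<^sub>R vec 1 \<in> span (columns X)"
        using eps matrix_vector_mult_in_columnspace[of X b2] by simp
      then have "eps \<in> span (insert (vec 1) (columns X))"
        using span_breakdown_eq by blast
      then show False using nondeg False by (simp add: X_def)
    qed
    then show ?thesis by simp
  qed
  obtain D2 where D2: "D2 > 0" "\<And>N. T N > 0 \<Longrightarrow> marglik X a (y N) =
      (ennreal ((2 * pi) powr (- real CARD('n) / 2) * ((a - 2) / 2)) * variance_mass m * intercept_mass (real CARD('n)))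
      * (ennreal D2 * hyperg_integral (e - d) m (T N) ((norm r2)\<^sup>2))"
  proof (rule marglik_hyperg_integral[OF inj a_gt Z])
    have ed: "(real CARD('n) - 1) / 2 - a / 2 - real CARD('p1 + 'p2) / 2 = e - d"
      by (simp add: e_def d_def m_def field_simps)
    fix D
    assume "D > 0" and *: "\<And>y c b r. y = c *\<^sub>R vec 1 + X *v b + r \<Longrightarrow> vec 1 \<bullet> r = 0 \<Longrightarrow> (\<And>x. r \<bullet> (X *v x) = 0) \<Longrightarrow>
      (norm y)\<^sup>2 - (vec 1 \<bullet> y)\<^sup>2 / real CARD('n) > 0 \<Longrightarrow>
      marglik X a y =
        (ennreal ((2 * pi) powr (- real CARD('n) / 2) * ((a - 2) / 2))
          * variance_mass ((real CARD('n) - 1) / 2) * intercept_mass (real CARD('n)))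
        * (ennreal D * hyperg_integral ((real CARD('n) - 1) / 2 - a / 2 - real CARD('p1 + 'p2) / 2) ((real CARD('n) - 1) / 2)
            ((norm y)\<^sup>2 - (vec 1 \<bullet> y)\<^sup>2 / real CARD('n)) ((norm r)\<^sup>2))"
    show thesis
      by (rule that[OF \<open>D > 0\<close>], rule *[OF y2 r2, folded T_def, unfolded ed, folded m_def])
  qed
  obtain D1 where D1: "D1 > 0" "\<And>N. T N > 0 \<Longrightarrow> marglik X1 a (y N) =
      (ennreal ((2 * pi) powr (- real CARD('n) / 2) * ((a - 2) / 2)) * variance_mass m * intercept_mass (real CARD('n)))
      * (ennreal D1 * hyperg_integral e m (T N) ((norm r1)\<^sup>2))"
  proof (rule marglik_hyperg_integral[OF inj1 a_gt Z1])
    fix D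
    assume "D > 0" and *: "\<And>y c b r. y = c *\<^sub>R vec 1 + X1 *v b + r \<Longrightarrow> vec 1 \<bullet> r = 0 \<Longrightarrow> (\<And>x. r \<bullet> (X1 *v x) = 0) \<Longrightarrow>
      (norm y)\<^sup>2 - (vec 1 \<bullet> y)\<^sup>2 / real CARD('n) > 0 \<Longrightarrow>
      marglik X1 a y =
        (ennreal ((2 * pi) powr (- real CARD('n) / 2) * ((a - 2) / 2))
          * variance_mass ((real CARD('n) - 1) / 2) * intercept_mass (real CARD('n)))
        * (ennreal D * hyperg_integral ((real CARD('n) - 1) / 2 - a / 2 - real CARD('p1) / 2) ((real CARD('n) - 1) / 2)
            ((norm y)\<^sup>2 - (vec 1 \<bullet> y)\<^sup>2 / real CARD('n)) ((norm r)\<^sup>2))"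
    show thesis
      by (rule that[OF \<open>D > 0\<close>], rule *[OF y1 r1, folded T_def, folded m_def, folded e_def])
  qed
  have "((\<lambda>N. marglik X a (y N) / marglik X1 a (y N)) \<longlongrightarrow> 0) sequentially"
  proof (rule tendsto_zero_ennreal_divide)
    fix \<epsilon> :: real
    assume \<epsilon>: "\<epsilon> > 0"
    \<comment> \<open>The tolerance is rescaled to absorb the model constants \<open>D1\<close> and
      \<open>D2\<close>.\<close>
    have "\<epsilon> * D1 / D2 > 0" using \<epsilon> D1(1) D2(1) by simp
    from hyperg_integral_eventually_small[OF e m d zero_le_power2 zero_le_power2 S T_inf this, of "norm r1"]
    have "eventually (\<lambda>N. hyperg_integral (e - d) m (T N) ((norm r2)\<^sup>2)
        \<le> ennreal (\<epsilon> * D1 / D2) * hyperg_integral e m (T N) ((norm r1)\<^sup>2)) sequentially" .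
    moreover have "eventually (\<lambda>N. T N > 0) sequentially"
      using T_inf unfolding filterlim_at_top_dense by blast
    ultimately show "eventually (\<lambda>N. marglik X a (y N) \<le> ennreal \<epsilon> * marglik X1 a (y N)) sequentially"
    proof eventually_elim
      case (elim N)
      have "ennreal D2 * hyperg_integral (e - d) m (T N) ((norm r2)\<^sup>2)
          \<le> ennreal D2 * (ennreal (\<epsilon> * D1 / D2) * hyperg_integral e m (T N) ((norm r1)\<^sup>2))"
        by (rule mult_left_mono[OF elim(1)]) simp
      also have "\<dots> = ennreal (D2 * (\<epsilon> * D1 / D2)) * hyperg_integral e m (T N) ((norm r1)\<^sup>2)"
        by (subst ennreal_mult[of D2]) (use D1(1) D2(1) \<epsilon> in \<open>simp_all add: mult.assoc\<close>)
      also have "D2 * (\<epsilon> * D1 / D2) = \<epsilon> * D1"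
        using D2(1) by simp
      also have "ennreal (\<epsilon> * D1) * hyperg_integral e m (T N) ((norm r1)\<^sup>2)
          = ennreal \<epsilon> * (ennreal D1 * hyperg_integral e m (T N) ((norm r1)\<^sup>2))"
        using D1(1) \<epsilon> by (simp add: ennreal_mult mult.assoc)
      finally show ?case
        \<comment> \<open>The factor common to both models is multiplied onto both sides, never
          cancelled.\<close>
        unfolding D2(2)[OF elim(2)] D1(2)[OF elim(2)] mult.left_commute[of "ennreal \<epsilon>"]
        by (rule mult_left_mono) simp
    qed
  qed
  then show ?thesis
    unfolding bayes_factor_def X_def y_def .
qed

end
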